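(* Let $m\ge 3$ be an integer and let $P$ be the uniform distribution on the boundary of a regular $m$-sided polygon inscribed in a unit circle in $\mathbb{R}^2$. Then the ($1$-dimensional) quantization coefficient $\lim_{n\to\infty} n^2 V_n(P)$ exists as a finite positive number and equals $\frac13 m^2\sin^2\left(\frac{\pi}{m}\right)$, i.e., \[\lim_{n\to\infty} n^2 V_n(P)=\frac13 m^2\sin^2\left(\frac{\pi}{m}\right).\]
   Context: For a Borel probability measure $P$ on $\mathbb{R}^2$ with Euclidean norm $\|\cdot\|$ and a finite nonempty set $\alpha\subset\mathbb{R}^2$, put $V(P;\alpha)=\int \min_{a\in\alpha}\|x-a\|^2\,dP(x)$. For $n\in\mathbb{N}$ the $n$th quantization error is $V_n(P)=\inf\{V(P;\alpha):\alpha\subset\mathbb{R}^2,\ 1\le \mathrm{card}(\alpha)\le n\}$. For $s\in(0,\infty)$ the $s$-dimensional quantization coefficient of $P$ is $\lim_{n\to\infty} n^{2/s}V_n(P)$, if it exists; here $s=1$. The uniform distribution on the boundary of a polygon is the normalized arc-length measure on the boundary (the union of its $m$ sides), i.e. it has constant density $\frac{1}{m\ell}$ with respect to arc length, where $\ell$ is the side length. *)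

theory Defs
  imports "HOL-Probability.Probability"
begin

text \<open>
  The integral is the Lebesgue integral of a nonnegative function, with values in
  \<^typ>\<open>ennreal\<close>: a measure with infinite second moment has infinite quantization errors.
  Only finite nonempty sets \<open>\<alpha>\<close> are meaningful arguments.
\<close>

definition distortion :: "(real^2) measure \<Rightarrow> (real^2) set \<Rightarrow> ennreal" where
  "distortion P \<alpha> = (\<integral>\<^sup>+ x. ennreal (Min ((\<lambda>a. (norm (x - a))\<^sup>2) ` \<alpha>)) \<partial>P)"

definition quantization_error :: "(real^2) measure \<Rightarrow> nat \<Rightarrow> ennreal" where
  "quantization_error P n =
     (INF \<alpha>\<in>{\<alpha>. finite \<alpha> \<and> 1 \<le> card \<alpha> \<and> card \<alpha> \<le> n}. distortion P \<alpha>)"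

text \<open>
  \<open>has_quantization_coefficient P s c\<close>: the limit of \<open>n\<^bsup>2/s\<^esup> V\<^sub>n(P)\<close> exists and is the finite
  number \<open>c\<close> (assumed nonnegative, since \<^const>\<open>ennreal\<close> truncates negative reals).
\<close>

definition has_quantization_coefficient :: "(real^2) measure \<Rightarrow> real \<Rightarrow> real \<Rightarrow> bool" where
  "has_quantization_coefficient P s c \<longleftrightarrow>
     (\<lambda>n. ennreal (real n powr (2 / s)) * quantization_error P n) \<longlonglongrightarrow> ennreal c"

text \<open>Arc length on the segment from \<open>a\<close> to \<open>b\<close>, via the unit-speed parametrization.\<close>

definition segment_arclength :: "real^2 \<Rightarrow> real^2 \<Rightarrow> (real^2) measure" where
  "segment_arclength a b =
     distr (restrict_space lborel {0..dist a b}) borel (\<lambda>t. a + (t / dist a b) *\<^sub>R (b - a))"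

text \<open>
  The regular \<open>m\<close>-gons inscribed in the unit circle with centre \<open>c\<close> are parametrized by a
  rotation angle \<open>\<theta>\<close>. Vertex \<open>m\<close> coincides with vertex \<open>0\<close>.
\<close>

definition polygon_vertex :: "nat \<Rightarrow> real^2 \<Rightarrow> real \<Rightarrow> nat \<Rightarrow> real^2" where
  "polygon_vertex m c \<theta> k =
     c + vector [cos (\<theta> + 2 * pi * real k / real m), sin (\<theta> + 2 * pi * real k / real m)]"

definition polygon_side_length :: "nat \<Rightarrow> real^2 \<Rightarrow> real \<Rightarrow> real" where
  "polygon_side_length m c \<theta> = dist (polygon_vertex m c \<theta> 0) (polygon_vertex m c \<theta> 1)"

text \<open>
  Arc length on the boundary is the sum of the arc lengths on the \<open>m\<close> sides; two sides share
  at most a vertex, which has arc length \<open>0\<close>.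
\<close>

definition polygon_arclength :: "nat \<Rightarrow> real^2 \<Rightarrow> real \<Rightarrow> (real^2) measure" where
  "polygon_arclength m c \<theta> = measure_of UNIV (sets borel)
     (\<lambda>A. \<Sum>k<m. emeasure
        (segment_arclength (polygon_vertex m c \<theta> k) (polygon_vertex m c \<theta> (Suc k))) A)"

definition uniform_polygon :: "nat \<Rightarrow> real^2 \<Rightarrow> real \<Rightarrow> (real^2) measure" where
  "uniform_polygon m c \<theta> =
     density (polygon_arclength m c \<theta>)
       (\<lambda>_. ennreal (1 / (real m * polygon_side_length m c \<theta>)))"

lemma sets_segment_arclength [simp, measurable_cong]: "sets (segment_arclength a b) = sets borel"
  by (simp add: segment_arclength_def)

lemma emeasure_segment_arclength:
  assumes "A \<in> sets borel"
  shows "emeasure (segment_arclength a b) A =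
           emeasure lborel {t \<in> {0..dist a b}. a + (t / dist a b) *\<^sub>R (b - a) \<in> A}"
proof -
  have meas: "(\<lambda>t. a + (t / dist a b) *\<^sub>R (b - a)) \<in> borel_measurable borel"
    by measurable
  have "(\<lambda>t. a + (t / dist a b) *\<^sub>R (b - a))
          \<in> borel_measurable (restrict_space lborel {0..dist a b})"
    by (rule measurable_restrict_space1) (use meas in simp)
  moreover have "(\<lambda>t. a + (t / dist a b) *\<^sub>R (b - a)) -` A \<inter> {0..dist a b}
      = {t \<in> {0..dist a b}. a + (t / dist a b) *\<^sub>R (b - a) \<in> A}"
    by auto
  ultimately show ?thesis
    using assms unfolding segment_arclength_def
    by (subst emeasure_distr)
      (auto simp: space_restrict_space intro!: emeasure_restrict_space)
qed

lemma sets_polygon_arclength [simp, measurable_cong]: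
  "sets (polygon_arclength m c \<theta>) = sets borel"
  using sets.sigma_sets_eq[of "borel :: (real^2) measure"]
  by (simp add: polygon_arclength_def sets_measure_of_conv)

lemma space_polygon_arclength [simp]: "space (polygon_arclength m c \<theta>) = UNIV"
  by (simp add: polygon_arclength_def space_measure_of_conv)

lemma emeasure_polygon_arclength:
  assumes "A \<in> sets borel"
  shows "emeasure (polygon_arclength m c \<theta>) A =
    (\<Sum>k<m. emeasure
        (segment_arclength (polygon_vertex m c \<theta> k) (polygon_vertex m c \<theta> (Suc k))) A)"
proof (rule emeasure_measure_of[OF polygon_arclength_def])
  show "countably_additive (sets (polygon_arclength m c \<theta>))
    (\<lambda>A. \<Sum>k<m. emeasure
        (segment_arclength (polygon_vertex m c \<theta> k) (polygon_vertex m c \<theta> (Suc k))) A)"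
  proof (rule countably_additiveI)
    fix F :: "nat \<Rightarrow> (real^2) set"
    assume F: "range F \<subseteq> sets (polygon_arclength m c \<theta>)" "disjoint_family F"
    let ?M = "\<lambda>k. segment_arclength (polygon_vertex m c \<theta> k) (polygon_vertex m c \<theta> (Suc k))"
    have "(\<Sum>i. \<Sum>k<m. emeasure (?M k) (F i)) = (\<Sum>k<m. \<Sum>i. emeasure (?M k) (F i))"
      by (rule suminf_sum) (rule summableI)
    also have "\<dots> = (\<Sum>k<m. emeasure (?M k) (\<Union>i. F i))"
      using F by (intro sum.cong suminf_emeasure) auto
    finally show "(\<Sum>i. \<Sum>k<m. emeasure (?M k) (F i)) = (\<Sum>k<m. emeasure (?M k) (\<Union>i. F i))" .
  qed
qed (use assms in \<open>simp_all add: positive_def\<close>)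

lemma dist_polygon_vertex_Suc:
  assumes "m \<ge> 3"
  shows "dist (polygon_vertex m c \<theta> k) (polygon_vertex m c \<theta> (Suc k)) = 2 * sin (pi / real m)"
proof -
  let ?x = "\<theta> + 2 * pi * real k / real m" and ?h = "2 * pi / real m"
  have step: "\<theta> + 2 * pi * real (Suc k) / real m = ?x + ?h"
    by (simp add: field_simps add_divide_distrib)
  have "(cos ?x - cos (?x + ?h))\<^sup>2 + (sin ?x - sin (?x + ?h))\<^sup>2
          = 2 - 2 * (cos ?x * cos (?x + ?h) + sin ?x * sin (?x + ?h))"
    using sin_cos_squared_add[of ?x] sin_cos_squared_add[of "?x + ?h"]
    by (simp add: power2_diff algebra_simps)
  also have "\<dots> = 2 - 2 * cos ?h"
    using cos_diff[of "?x + ?h" ?x] by (simp add: mult.commute)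
  also have "\<dots> = (2 * sin (pi / real m))\<^sup>2"
    using cos_double_sin[of "pi / real m"] by (simp add: power_mult_distrib)
  finally have sq: "(cos ?x - cos (?x + ?h))\<^sup>2 + (sin ?x - sin (?x + ?h))\<^sup>2
      = (2 * sin (pi / real m))\<^sup>2" .
  have "pi / real m \<le> pi"
    using assms by (simp add: divide_le_eq)
  then have "sin (pi / real m) \<ge> 0"
    by (intro sin_ge_zero) auto
  moreover have "dist (polygon_vertex m c \<theta> k) (polygon_vertex m c \<theta> (Suc k))
    = sqrt ((cos ?x - cos (?x + ?h))\<^sup>2 + (sin ?x - sin (?x + ?h))\<^sup>2)"
    unfolding polygon_vertex_def step
    by (simp add: dist_vec_def L2_set_def sum_2 dist_real_def)
  ultimately show ?thesis
    by (simp only: sq real_sqrt_abs)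
qed

lemma polygon_side_length_eq:
  "m \<ge> 3 \<Longrightarrow> polygon_side_length m c \<theta> = 2 * sin (pi / real m)"
  using dist_polygon_vertex_Suc[of m c \<theta> 0] by (simp add: polygon_side_length_def)

lemma sets_uniform_polygon [simp, measurable_cong]: "sets (uniform_polygon m c \<theta>) = sets borel"
  by (simp add: uniform_polygon_def)

lemma prob_space_uniform_polygon:
  assumes "m \<ge> 3"
  shows "prob_space (uniform_polygon m c \<theta>)"
proof
  have pos: "sin (pi / real m) > 0"
    using assms by (intro sin_gt_zero) (auto simp: divide_less_eq)
  have "{t. 0 \<le> t \<and> t \<le> 2 * sin (pi / real m)} = {0..2 * sin (pi / real m)}"
    by auto
  then have "emeasure (polygon_arclength m c \<theta>) UNIV = ennreal (real m * (2 * sin (pi / real m)))"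
    using pos assms
    by (simp add: emeasure_polygon_arclength emeasure_segment_arclength dist_polygon_vertex_Suc
        ennreal_of_nat_eq_real_of_nat flip: ennreal_mult)
  then show "emeasure (uniform_polygon m c \<theta>) (space (uniform_polygon m c \<theta>)) = 1"
    using pos assms
    by (simp add: uniform_polygon_def emeasure_density_const polygon_side_length_eq
        flip: ennreal_mult)
qed

end

theory Submission
  imports Defs
begin

text \<open>
  Write \<open>l\<close> for the side length. The upper bound places \<open>n div m\<close> equally spaced midpoints on each
  side. For the lower bound, cut off length \<open>\<epsilon>\<close> at both ends of each side, so that the remaining
  pieces, of total length \<open>L = m * (l - 2 * \<epsilon>)\<close>, have positive mutual distance. With
  \<open>u\<^sup>+ = max 0 u\<close>, every \<open>x\<close> satisfies
  \<open>R\<^sup>2 \<le> min\<^sub>a \<bar>x - a\<bar>\<^sup>2 + (\<Sum>a. (R\<^sup>2 - \<bar>x - a\<bar>\<^sup>2)\<^sup>+)\<close>. For small \<open>R\<close> the ball of radius \<open>R\<close> around \<open>a\<close>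
  meets only one piece, so the summand of \<open>a\<close> contributes at most \<open>4 * R ^ 3 / 3\<close> to the integral.
  The choice \<open>R = L / (2 * n)\<close> maximizes \<open>L * R\<^sup>2 - n * (4 * R ^ 3 / 3)\<close> and gives
  \<open>L ^ 3 / (12 * n\<^sup>2)\<close>; then let \<open>\<epsilon>\<close> tend to \<open>0\<close>.
\<close>

section \<open>Unit-speed parametrization of a segment\<close>

text \<open>The map pushed forward in \<open>segment_arclength\<close>, stated for any normed space
  so that its metric properties are available separately.\<close>

definition unit_param :: "'a::real_normed_vector \<Rightarrow> 'a \<Rightarrow> real \<Rightarrow> 'a" where
  "unit_param p q t = p + (t / dist p q) *\<^sub>R (q - p)"

lemma continuous_unit_param [continuous_intros]: "continuous_on A (unit_param p q)"
proof -
  have "unit_param p q = (\<lambda>t. p + t *\<^sub>R ((1 / dist p q) *\<^sub>R (q - p)))"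
    by (simp add: unit_param_def fun_eq_iff)
  then show ?thesis
    by (simp only:) (intro continuous_intros)
qed

lemma borel_measurable_unit_param [measurable]:
  "unit_param p (q :: 'a::euclidean_space) \<in> borel_measurable borel"
  by (intro borel_measurable_continuous_onI continuous_unit_param)

lemma norm_unit_param_diff:
  assumes "p \<noteq> q"
  shows "norm (unit_param p q s - unit_param p q t) = \<bar>s - t\<bar>"
proof -
  have "unit_param p q s - unit_param p q t = ((s - t) / dist p q) *\<^sub>R (q - p)"
    by (simp add: unit_param_def algebra_simps diff_divide_distrib)
  then show ?thesis
    using assms by (simp add: dist_norm norm_minus_commute)
qed

text \<open>\<open>u\<close> is the coordinate of the orthogonal projection of \<open>a\<close> onto
  the line through \<open>p\<close> and \<open>q\<close>. By Cauchy-Schwarz, projecting to the unit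
  direction cannot increase length, so planar distances are bounded below by distances on a
  line.\<close>

lemma unit_param_foot:
  fixes p q :: "'a::real_inner"
  assumes "p \<noteq> q"
  obtains u where "\<And>t. (t - u)\<^sup>2 \<le> (norm (unit_param p q t - a))\<^sup>2"
proof
  fix t
  let ?e = "(1 / dist p q) *\<^sub>R (q - p)"
  let ?u = "(a - p) \<bullet> ?e"
  have e: "norm ?e = 1"
    using assms by (simp add: dist_norm norm_minus_commute)
  have e': "?e \<bullet> ?e = 1"
    using e by (simp only: norm_eq_1)
  have "unit_param p q t - a = t *\<^sub>R ?e - (a - p)"
    by (simp add: unit_param_def)
  then have "(unit_param p q t - a) \<bullet> ?e = t * (?e \<bullet> ?e) - (a - p) \<bullet> ?e"
    by (simp only: inner_diff_left inner_scaleR_left)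
  then have "t - ?u = (unit_param p q t - a) \<bullet> ?e"
    unfolding e' by simp
  then have "\<bar>t - ?u\<bar> \<le> norm (unit_param p q t - a)"
    using Cauchy_Schwarz_ineq2[of "unit_param p q t - a" ?e] unfolding e by simp
  then show "(t - ?u)\<^sup>2 \<le> (norm (unit_param p q t - a))\<^sup>2"
    by (metis abs_ge_zero power2_abs power_mono)
qed

section \<open>One-dimensional integrals and the contribution of one centre\<close>

text \<open>\<open>ennreal\<close> sends negative values to 0, so the integrand is the positive part
  of the parabola and vanishes outside \<open>{u - R..u + R}\<close>.\<close>

lemma nn_integral_parabola_cap:
  assumes "R \<ge> 0"
  shows "(\<integral>\<^sup>+ t. ennreal (R\<^sup>2 - (t - u)\<^sup>2) \<partial>lborel) = ennreal (4 * R ^ 3 / 3)"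
proof -
  let ?F = "\<lambda>t. R\<^sup>2 * (t - u) - (t - u) ^ 3 / 3"
  have "t \<notin> {u - R..u + R} \<Longrightarrow> R\<^sup>2 \<le> (t - u)\<^sup>2" for t
    using assms by (intro abs_le_square_iff[THEN iffD1]) auto
  moreover have nn: "t \<in> {u - R..u + R} \<Longrightarrow> (t - u)\<^sup>2 \<le> R\<^sup>2" for t
    using assms by (intro abs_le_square_iff[THEN iffD1]) auto
  ultimately have "(\<integral>\<^sup>+ t. ennreal (R\<^sup>2 - (t - u)\<^sup>2) \<partial>lborel)
      = (\<integral>\<^sup>+ t. ennreal (R\<^sup>2 - (t - u)\<^sup>2) * indicator {u - R..u + R} t \<partial>lborel)"
    by (intro nn_integral_cong) (auto simp: indicator_def ennreal_neg)
  also have "\<dots> = ennreal (?F (u + R) - ?F (u - R))"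
  proof (intro nn_integral_FTC_Icc)
    fix t assume "t \<in> {u - R..u + R}"
    then show "0 \<le> R\<^sup>2 - (t - u)\<^sup>2"
      using nn by simp
  qed (use assms in \<open>auto intro!: derivative_eq_intros simp: power2_eq_square field_simps\<close>)
  also have "?F (u + R) - ?F (u - R) = 4 * R ^ 3 / 3"
    by (simp add: power2_eq_square power3_eq_cube field_simps)
  finally show ?thesis .
qed

lemma nn_integral_square_Icc:
  assumes "h \<ge> 0"
  shows "(\<integral>\<^sup>+ t. ennreal ((t - u)\<^sup>2) * indicator {u - h..u + h} t \<partial>lborel)
    = ennreal (2 * h ^ 3 / 3)"
proof -
  let ?F = "\<lambda>t. (t - u) ^ 3 / 3"
  have "(\<integral>\<^sup>+ t. ennreal ((t - u)\<^sup>2) * indicator {u - h..u + h} t \<partial>lborel)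
      = ennreal (?F (u + h) - ?F (u - h))"
  proof (intro nn_integral_FTC_Icc)
    show "0 \<le> (t - u)\<^sup>2" for t
      by simp
  qed (use assms in \<open>auto intro!: derivative_eq_intros simp: power2_eq_square field_simps\<close>)
  also have "?F (u + h) - ?F (u - h) = 2 * h ^ 3 / 3"
    by (simp add: power3_eq_cube field_simps)
  finally show ?thesis .
qed

text \<open>Moving \<open>a\<close> to its foot on the line can only raise the cap, and restricting
  to \<open>A\<close> can only lower the integral. The bound is therefore uniform in
  \<open>a\<close> and \<open>A\<close>.\<close>

lemma nn_integral_cap_unit_param_le:
  fixes p q :: "'a::euclidean_space"
  assumes "p \<noteq> q" "R \<ge> 0"
  shows "(\<integral>\<^sup>+ t. ennreal (R\<^sup>2 - (norm (unit_param p q t - a))\<^sup>2) * indicator A t \<partial>lborel)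
    \<le> ennreal (4 * R ^ 3 / 3)"
proof -
  obtain u where "\<And>t. (t - u)\<^sup>2 \<le> (norm (unit_param p q t - a))\<^sup>2"
    using unit_param_foot[OF assms(1)] by metis
  then have "(\<integral>\<^sup>+ t. ennreal (R\<^sup>2 - (norm (unit_param p q t - a))\<^sup>2) * indicator A t \<partial>lborel)
      \<le> (\<integral>\<^sup>+ t. ennreal (R\<^sup>2 - (t - u)\<^sup>2) \<partial>lborel)"
    by (intro nn_integral_mono) (auto simp: indicator_def intro!: ennreal_leI)
  then show ?thesis
    using assms by (simp add: nn_integral_parabola_cap)
qed

text \<open>
  If \<open>2 * R \<le> \<delta>\<close>, the open ball of radius \<open>R\<close> around \<open>a\<close> meets at most one of the segments.
\<close>

lemma sum_nn_integral_cap_le: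
  fixes p q :: "'i \<Rightarrow> 'a::euclidean_space"
  assumes "finite I" "\<And>i. i \<in> I \<Longrightarrow> p i \<noteq> q i" "R \<ge> 0" "2 * R \<le> \<delta>"
    and sep: "\<And>i j s t. \<lbrakk>i \<in> I; j \<in> I; i \<noteq> j; s \<in> A; t \<in> A\<rbrakk> \<Longrightarrow>
      \<delta> \<le> dist (unit_param (p i) (q i) s) (unit_param (p j) (q j) t)"
  shows "(\<Sum>i\<in>I. \<integral>\<^sup>+ t. ennreal (R\<^sup>2 - (norm (unit_param (p i) (q i) t - a))\<^sup>2) * indicator A t \<partial>lborel)
    \<le> ennreal (4 * R ^ 3 / 3)"
proof -
  let ?g = "\<lambda>i. unit_param (p i) (q i)"
  let ?N = "\<lambda>i. \<integral>\<^sup>+ t. ennreal (R\<^sup>2 - (norm (?g i t - a))\<^sup>2) * indicator A t \<partial>lborel"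
  have zero: "?N i = 0" if "\<And>t. t \<in> A \<Longrightarrow> R \<le> norm (?g i t - a)" for i
  proof -
    have "?N i = (\<integral>\<^sup>+ t. 0 \<partial>(lborel :: real measure))"
      using that \<open>R \<ge> 0\<close>
      by (intro nn_integral_cong) (auto simp: indicator_def ennreal_neg power_mono)
    then show ?thesis by simp
  qed
  show ?thesis
  proof (cases "\<exists>i\<in>I. \<exists>t\<in>A. norm (?g i t - a) < R")
    case True
    then obtain i s where i: "i \<in> I" "s \<in> A" "norm (?g i s - a) < R"
      by blast
    have "?N j = 0" if "j \<in> I - {i}" for j
    proof (rule zero)
      fix t assume "t \<in> A"
      then have "\<delta> \<le> dist (?g i s) (?g j t)"
        using i that by (intro sep) auto
      also have "\<dots> \<le> norm (?g i s - a) + norm (?g j t - a)"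
        using dist_triangle3[of "?g i s" "?g j t" a] by (simp add: dist_norm norm_minus_commute)
      finally show "R \<le> norm (?g j t - a)"
        using i \<open>2 * R \<le> \<delta>\<close> by simp
    qed
    then have "(\<Sum>j\<in>I. ?N j) = ?N i"
      using i assms(1) by (subst sum.remove[of I i]) auto
    then show ?thesis
      using nn_integral_cap_unit_param_le[of "p i" "q i" R a A] i assms by simp
  next
    case False
    then have "(\<Sum>j\<in>I. ?N j) = 0"
      using zero by (intro sum.neutral ballI) (auto simp: not_less)
    then show ?thesis by simp
  qed
qed

text \<open>A minimizer \<open>a\<close> suffices: \<open>f a\<close> plus the positive part of
  \<open>r - f a\<close> is at least \<open>r\<close>, and the remaining summands are
  nonnegative.\<close>

lemma square_le_Min_plus_sum_cap:
  fixes f :: "'a \<Rightarrow> real"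
  assumes "finite \<alpha>" "\<alpha> \<noteq> {}"
  shows "ennreal r \<le> ennreal (Min (f ` \<alpha>)) + (\<Sum>a\<in>\<alpha>. ennreal (r - f a))"
proof -
  have "Min (f ` \<alpha>) \<in> f ` \<alpha>"
    using assms by (intro Min_in) auto
  then obtain a where a: "a \<in> \<alpha>" "Min (f ` \<alpha>) = f a"
    by blast
  have "ennreal r \<le> ennreal (max 0 (f a) + max 0 (r - f a))"
    by (intro ennreal_leI) auto
  also have "\<dots> = ennreal (f a) + ennreal (r - f a)"
    by (simp add: ennreal_plus)
  also have "ennreal (r - f a) \<le> (\<Sum>a\<in>\<alpha>. ennreal (r - f a))"
    using assms a by (intro member_le_sum) auto
  finally show ?thesis
    using a by (simp add: add_left_mono)
qed

section \<open>Integrals over the polygon as integrals over its sides\<close>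

lemma nn_integral_segment_arclength:
  assumes [measurable]: "f \<in> borel_measurable borel"
  shows "(\<integral>\<^sup>+ x. f x \<partial>segment_arclength a b)
    = (\<integral>\<^sup>+ t. f (unit_param a b t) * indicator {0..dist a b} t \<partial>lborel)"
proof -
  have g: "unit_param a b \<in> borel_measurable (restrict_space lborel {0..dist a b})"
    by (rule measurable_restrict_space1) simp
  have "segment_arclength a b = distr (restrict_space lborel {0..dist a b}) borel (unit_param a b)"
    unfolding segment_arclength_def by (simp add: unit_param_def[abs_def])
  then show ?thesis
    using g by (simp add: nn_integral_distr nn_integral_restrict_space)
qed

text \<open>The measure is given by its values on Borel sets, so additivity is carried from
  indicators to all nonnegative Borel functions by linearity and monotone limits.\<close>

lemma nn_integral_polygon_arclength:
  assumes "f \<in> borel_measurable borel"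
  shows "(\<integral>\<^sup>+ x. f x \<partial>polygon_arclength m c \<theta>) = (\<Sum>k<m. \<integral>\<^sup>+ x. f x
    \<partial>segment_arclength (polygon_vertex m c \<theta> k) (polygon_vertex m c \<theta> (Suc k)))"
    (is "_ = (\<Sum>k<m. nn_integral (?M k) _)")
  using assms
proof (induction rule: borel_measurable_induct)
  case (cong f g)
  then show ?case by (simp cong: nn_integral_cong)
next
  case (set A)
  then show ?case by (simp add: emeasure_polygon_arclength)
next
  case (mult u v)
  then show ?case by (simp add: nn_integral_cmult sum_distrib_left)
next
  case (add u v)
  then show ?case by (simp add: nn_integral_add sum.distrib)
next
  case (seq U)
  have [measurable]: "U i \<in> borel_measurable borel" for i
    using seq by simp
  have inc: "incseq (\<lambda>i. nn_integral (?M k) (U i))" for k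
    using seq(3) by (auto simp: incseq_def le_fun_def intro!: nn_integral_mono)
  have "(\<integral>\<^sup>+ x. (SUP i. U i x) \<partial>polygon_arclength m c \<theta>)
      = (SUP i. \<integral>\<^sup>+ x. U i x \<partial>polygon_arclength m c \<theta>)"
    using seq by (intro nn_integral_monotone_convergence_SUP) auto
  also have "\<dots> = (SUP i. \<Sum>k<m. nn_integral (?M k) (U i))"
    using seq by simp
  also have "\<dots> = (\<Sum>k<m. SUP i. nn_integral (?M k) (U i))"
    using inc by (intro ennreal_SUP_sum) auto
  also have "\<dots> = (\<Sum>k<m. \<integral>\<^sup>+ x. (SUP i. U i x) \<partial>?M k)"
    using seq by (intro sum.cong refl nn_integral_monotone_convergence_SUP[symmetric]) auto
  finally show ?case by (simp add: image_comp)
qed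


text \<open>Both bounds start from this form, in which only integrals over the parameter interval of
  a side remain.\<close>

lemma distortion_uniform_polygon:
  fixes m :: nat and c :: "real^2" and \<theta> :: real
  assumes "m \<ge> 3" "finite \<alpha>"
  defines "l \<equiv> 2 * sin (pi / real m)"
    and "g \<equiv> \<lambda>k. unit_param (polygon_vertex m c \<theta> k) (polygon_vertex m c \<theta> (Suc k))"
  shows "distortion (uniform_polygon m c \<theta>) \<alpha> = ennreal (1 / (real m * l)) *
    (\<Sum>k<m. \<integral>\<^sup>+ t. ennreal (Min ((\<lambda>a. (norm (g k t - a))\<^sup>2) ` \<alpha>)) * indicator {0..l} t \<partial>lborel)"
proof -
  have [measurable]: "(\<lambda>x. ennreal (Min ((\<lambda>a. (norm (x - a))\<^sup>2) ` \<alpha>))) \<in> borel_measurable borel"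
    using assms(2) by measurable
  show ?thesis
    using assms(1)
    by (simp add: distortion_def uniform_polygon_def nn_integral_density nn_integral_cmult
        nn_integral_polygon_arclength nn_integral_segment_arclength polygon_side_length_eq
        dist_polygon_vertex_Suc l_def g_def)
qed

section \<open>Positive distance between the trimmed sides\<close>

lemma polygon_side_pos:
  assumes "m \<ge> 3"
  shows "0 < 2 * sin (pi / real m)"
  using assms by (auto intro!: sin_gt_zero simp: divide_less_eq)

lemma polygon_vertex_neq_Suc:
  "m \<ge> 3 \<Longrightarrow> polygon_vertex m c \<theta> k \<noteq> polygon_vertex m c \<theta> (Suc k)"
  using polygon_side_pos[of m] dist_polygon_vertex_Suc[of m c \<theta> k] by auto

text \<open>Write \<open>cos a - cos \<psi>\<close> as a product of two sines; both half-angles lie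
  strictly between 0 and \<open>pi\<close>.\<close>

lemma cos_less_outside:
  assumes "0 < a" "a < \<psi>" "\<psi> < 2 * pi - a"
  shows "cos \<psi> < cos a"
proof -
  have "0 < sin ((a + \<psi>) / 2)" "0 < sin ((\<psi> - a) / 2)"
    using assms by (auto intro!: sin_gt_zero)
  then have "0 < 2 * sin ((a + \<psi>) / 2) * sin ((\<psi> - a) / 2)"
    by simp
  then show ?thesis
    using cos_diff_cos[of a \<psi>] by linarith
qed

text \<open>
  The normal to side \<open>k\<close> separates it from side \<open>j\<close>: on side \<open>k\<close> the normal coordinate is
  \<open>cos (pi / m)\<close>, at vertex \<open>j\<close> it is \<open>cos ((2 * (k - j) + 1) * pi / m)\<close>, and only vertices
  \<open>k\<close> and \<open>k + 1\<close> (mod \<open>m\<close>) attain \<open>cos (pi / m)\<close>.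
\<close>

lemma polygon_open_sides_disjoint:
  assumes "m \<ge> 3" "j < k" "k < m"
    and s: "0 < s" "s < 2 * sin (pi / real m)" and t: "0 < t" "t < 2 * sin (pi / real m)"
  shows "unit_param (polygon_vertex m c \<theta> j) (polygon_vertex m c \<theta> (Suc j)) s
    \<noteq> unit_param (polygon_vertex m c \<theta> k) (polygon_vertex m c \<theta> (Suc k)) t"
proof -
  let ?v = "polygon_vertex m c \<theta>" and ?l = "2 * sin (pi / real m)"
  \<comment> \<open>The unit normal of side \<open>k\<close>: its angle is halfway between the
    angles of vertices \<open>k\<close> and \<open>k + 1\<close>.\<close>
  define w :: "real^2" where "w = vector [cos (\<theta> + (2 * real k + 1) * pi / real m),
      sin (\<theta> + (2 * real k + 1) * pi / real m)]"
  have v: "(?v i - c) \<bullet> w = cos ((2 * real k + 1 - 2 * real i) * pi / real m)" for i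
  proof -
    have "(?v i - c) \<bullet> w
        = cos ((\<theta> + (2 * real k + 1) * pi / real m) - (\<theta> + 2 * pi * real i / real m))"
      unfolding cos_diff by (simp add: w_def polygon_vertex_def inner_vec_def sum_2)
    also have "(\<theta> + (2 * real k + 1) * pi / real m) - (\<theta> + 2 * pi * real i / real m)
        = (2 * real k + 1 - 2 * real i) * pi / real m"
      using assms(1) by (simp add: field_simps)
    finally show ?thesis .
  qed
  have x: "(unit_param (?v i) (?v (Suc i)) r - c) \<bullet> w
      = (1 - r / ?l) * ((?v i - c) \<bullet> w) + r / ?l * ((?v (Suc i) - c) \<bullet> w)" for i r
  proof -
    have "unit_param (?v i) (?v (Suc i)) r - c
        = (1 - r / ?l) *\<^sub>R (?v i - c) + (r / ?l) *\<^sub>R (?v (Suc i) - c)"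
      using assms(1) unfolding unit_param_def
      by (simp only: dist_polygon_vertex_Suc) (simp add: algebra_simps)
    then show ?thesis
      by (simp add: inner_add_left)
  qed
  let ?a = "pi / real m" and ?d = "real k - real j"
  \<comment> \<open>Hence the multiples of \<open>pi / m\<close> belonging to the two ends of side
    \<open>j\<close>, namely \<open>2 * ?d + 1\<close> and \<open>2 * ?d - 1\<close>, lie between 1
    and \<open>2 * m - 1\<close>.\<close>
  have d: "1 \<le> ?d" "?d \<le> real m - 1"
    using assms(2,3) by (auto simp: Suc_leI)
  have less: "cos (r * pi / real m) < cos ?a" if "1 < r" "r < 2 * real m - 1" for r
  proof (rule cos_less_outside)
    show "?a < r * pi / real m"
      using that assms(1) by (simp add: divide_less_cancel)
    have "r * pi < (2 * real m - 1) * pi"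
      using that by simp
    then show "r * pi / real m < 2 * pi - ?a"
      using assms(1) by (simp add: field_simps)
  qed (use assms(1) in simp)
  have le: "cos (r * pi / real m) \<le> cos ?a" if "1 \<le> r" "r \<le> 2 * real m - 1" for r
  proof (cases "r = 1 \<or> r = 2 * real m - 1")
    case True
    moreover have "cos ((2 * real m - 1) * pi / real m) = cos ?a"
    proof -
      have "(2 * real m - 1) * pi / real m = 2 * pi - ?a"
        using assms(1) by (simp add: field_simps)
      then show ?thesis by (simp add: cos_diff)
    qed
    ultimately show ?thesis by auto
  qed (use less[of r] that in auto)
  have vj: "(?v j - c) \<bullet> w = cos ((2 * ?d + 1) * pi / real m)"
    "(?v (Suc j) - c) \<bullet> w = cos ((2 * ?d - 1) * pi / real m)"
    unfolding v by (simp_all add: algebra_simps)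
  have vk: "(?v k - c) \<bullet> w = cos ?a" "(?v (Suc k) - c) \<bullet> w = cos ?a"
    unfolding v by simp_all
  have s': "0 < s / ?l" "0 < 1 - s / ?l"
    using s by (auto simp: divide_less_eq)
  have lej: "(?v j - c) \<bullet> w \<le> cos ?a" "(?v (Suc j) - c) \<bullet> w \<le> cos ?a"
    unfolding vj using d by (auto intro!: le)
  \<comment> \<open>Vertex \<open>j\<close> attains equality only for \<open>?d = m - 1\<close>,
    vertex \<open>j + 1\<close> only for \<open>?d = 1\<close>. As \<open>m \<ge> 3\<close>, these
    cases exclude each other.\<close>
  have "(?v j - c) \<bullet> w < cos ?a \<or> (?v (Suc j) - c) \<bullet> w < cos ?a"
  proof (cases "?d = 1")
    case True
    then have "(?v j - c) \<bullet> w < cos ?a"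
      unfolding vj using assms(1) by (intro less) auto
    then show ?thesis ..
  next
    case False
    then have "(?v (Suc j) - c) \<bullet> w < cos ?a"
      unfolding vj using d by (intro less) auto
    then show ?thesis ..
  qed
  \<comment> \<open>Both weights are positive because \<open>s\<close> is an interior parameter, so
    strictness at one end passes to the convex combination.\<close>
  then have "(1 - s / ?l) * ((?v j - c) \<bullet> w) + s / ?l * ((?v (Suc j) - c) \<bullet> w)
      < (1 - s / ?l) * cos ?a + s / ?l * cos ?a"
  proof
    assume "(?v j - c) \<bullet> w < cos ?a"
    then show ?thesis
      using s' lej by (intro add_less_le_mono mult_strict_left_mono mult_left_mono) auto
  next
    assume "(?v (Suc j) - c) \<bullet> w < cos ?a"
    then show ?thesis
      using s' lej by (intro add_le_less_mono mult_strict_left_mono mult_left_mono) auto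
  qed
  then have "(unit_param (?v j) (?v (Suc j)) s - c) \<bullet> w < cos ?a"
    unfolding x by (simp add: algebra_simps)
  moreover have "(unit_param (?v k) (?v (Suc k)) t - c) \<bullet> w = cos ?a"
    unfolding x vk by (simp add: algebra_simps)
  ultimately show ?thesis by auto
qed

text \<open>Each pair of disjoint compact sets has positive distance. Phrasing this as a property of
  all small \<open>d > 0\<close> lets finitely many pairs be combined without forming a
  minimum.\<close>

lemma compact_family_separated:
  fixes K :: "'i \<Rightarrow> 'a::heine_borel set"
  assumes "finite I" "\<And>i. i \<in> I \<Longrightarrow> compact (K i)"
    and "\<And>i j. \<lbrakk>i \<in> I; j \<in> I; i \<noteq> j\<rbrakk> \<Longrightarrow> K i \<inter> K j = {}"
  obtains \<delta> where "\<delta> > 0"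
    and "\<And>i j x y. \<lbrakk>i \<in> I; j \<in> I; i \<noteq> j; x \<in> K i; y \<in> K j\<rbrakk> \<Longrightarrow> \<delta> \<le> dist x y"
proof -
  let ?P = "\<lambda>d i j. i \<noteq> j \<longrightarrow> (\<forall>x\<in>K i. \<forall>y\<in>K j. d \<le> dist x y)"
  have "\<forall>\<^sub>F d in at_right 0. ?P d i j" if "i \<in> I" "j \<in> I" for i j
  proof (cases "i = j")
    case False
    then have "compact (K i)" "closed (K j)" "K i \<inter> K j = {}"
      using assms(2,3) that by (auto simp: compact_imp_closed)
    from separate_compact_closed[OF this]
    obtain d where d: "d > 0" "\<forall>x\<in>K i. \<forall>y\<in>K j. d \<le> dist x y"
      by auto
    have "\<forall>\<^sub>F e in at_right 0. e < d"
      using d(1) by (intro eventually_at_rightI[of 0 d]) auto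
    then show ?thesis
    proof eventually_elim
      case (elim e)
      then show ?case
        using d(2) by (meson less_imp_le order_trans)
    qed
  qed simp
  then have "\<forall>\<^sub>F d in at_right 0. \<forall>i\<in>I. \<forall>j\<in>I. ?P d i j"
    using assms(1) by (simp add: eventually_ball_finite)
  then have "\<forall>\<^sub>F d in at_right 0. 0 < d \<and> (\<forall>i\<in>I. \<forall>j\<in>I. ?P d i j)"
    using eventually_at_right_less[of "0::real"] by (simp add: eventually_conj)
  from eventually_happens[OF this]
  obtain d where "0 < d" "\<forall>i\<in>I. \<forall>j\<in>I. ?P d i j"
    by auto
  then show ?thesis
    using that[of d] by simp
qed

text \<open>Trimming by \<open>\<epsilon>\<close> removes the shared vertices, so the remaining
  closed pieces are pairwise disjoint and compact.\<close>

lemma polygon_inner_sides_separated: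
  assumes "m \<ge> 3" "\<epsilon> > 0"
  obtains \<delta> where "\<delta> > 0"
    and "\<And>j k s t. \<lbrakk>j < m; k < m; j \<noteq> k; s \<in> {\<epsilon>..2 * sin (pi / real m) - \<epsilon>};
        t \<in> {\<epsilon>..2 * sin (pi / real m) - \<epsilon>}\<rbrakk> \<Longrightarrow>
      \<delta> \<le> dist (unit_param (polygon_vertex m c \<theta> j) (polygon_vertex m c \<theta> (Suc j)) s)
        (unit_param (polygon_vertex m c \<theta> k) (polygon_vertex m c \<theta> (Suc k)) t)"
proof -
  let ?g = "\<lambda>k. unit_param (polygon_vertex m c \<theta> k) (polygon_vertex m c \<theta> (Suc k))"
  let ?A = "{\<epsilon>..2 * sin (pi / real m) - \<epsilon>}"
  have lt: "?g j ` ?A \<inter> ?g k ` ?A = {}" if "j < k" "k < m" for j k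
    using polygon_open_sides_disjoint[of m j k, OF assms(1) that] \<open>\<epsilon> > 0\<close> by fastforce
  have "?g j ` ?A \<inter> ?g k ` ?A = {}" if "j \<in> {..<m}" "k \<in> {..<m}" "j \<noteq> k" for j k
  proof (cases "j < k")
    case True
    then show ?thesis using lt that by simp
  next
    case False
    then have "?g k ` ?A \<inter> ?g j ` ?A = {}" using that by (intro lt) auto
    then show ?thesis by blast
  qed
  moreover have "compact (?g k ` ?A)" for k
    by (intro compact_continuous_image continuous_unit_param) simp
  ultimately obtain \<delta> where \<delta>: "\<delta> > 0" "\<And>j k x y. \<lbrakk>j \<in> {..<m}; k \<in> {..<m}; j \<noteq> k;
      x \<in> ?g j ` ?A; y \<in> ?g k ` ?A\<rbrakk> \<Longrightarrow> \<delta> \<le> dist x y"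
    using compact_family_separated[of "{..<m}" "\<lambda>k. ?g k ` ?A"] by (metis finite_lessThan)
  show ?thesis
    by (rule that[OF \<delta>(1)], rule \<delta>(2)) auto
qed

section \<open>Lower bound for the quantization error\<close>

text \<open>The bound holds only for large \<open>n\<close>, because the radius \<open>R\<close>
  must be small against the distance between the pieces, which depends on
  \<open>\<epsilon>\<close>.\<close>

lemma quantization_error_polygon_ge:
  fixes m :: nat and \<epsilon> :: real
  defines "l \<equiv> 2 * sin (pi / real m)"
  defines "L \<equiv> real m * (l - 2 * \<epsilon>)"
  assumes m: "m \<ge> 3" and \<epsilon>: "0 < \<epsilon>" "2 * \<epsilon> < l"
  shows "\<forall>\<^sub>F n in sequentially. ennreal (L ^ 3 / (12 * real m * l * (real n)\<^sup>2))
    \<le> quantization_error (uniform_polygon m c \<theta>) n"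
proof -
  let ?p = "polygon_vertex m c \<theta>" and ?A = "{\<epsilon>..l - \<epsilon>}"
  let ?g = "\<lambda>k. unit_param (?p k) (?p (Suc k))"
  obtain \<delta> where \<delta>: "\<delta> > 0" "\<And>j k s t. \<lbrakk>j < m; k < m; j \<noteq> k; s \<in> ?A; t \<in> ?A\<rbrakk> \<Longrightarrow>
      \<delta> \<le> dist (?g j s) (?g k t)"
    unfolding l_def using polygon_inner_sides_separated[OF m \<epsilon>(1)] by blast
  have l: "l > 0"
    using polygon_side_pos[OF m] by (simp add: l_def)
  have L: "L > 0"
    using m \<epsilon> by (simp add: L_def)
  have "\<forall>\<^sub>F n in sequentially. L / \<delta> \<le> real n"
    using filterlim_real_sequentially unfolding filterlim_at_top by blast
  then show ?thesis
    using eventually_gt_at_top[of 0]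
  proof eventually_elim
    case (elim n)
    \<comment> \<open>With this radius, \<open>L / \<delta> \<le> n\<close> says exactly that
      \<open>2 * R \<le> \<delta>\<close>.\<close>
    define R where "R = L / (2 * real n)"
    have R: "R > 0" "2 * R \<le> \<delta>"
      using L \<delta>(1) elim by (auto simp: R_def field_simps)
    show ?case
      unfolding quantization_error_def
    proof (rule INF_greatest)
      fix \<alpha> :: "(real^2) set"
      assume "\<alpha> \<in> {\<alpha>. finite \<alpha> \<and> 1 \<le> card \<alpha> \<and> card \<alpha> \<le> n}"
      then have \<alpha>: "finite \<alpha>" "\<alpha> \<noteq> {}" "card \<alpha> \<le> n"
        by auto
      let ?D = "\<lambda>x. ennreal (Min ((\<lambda>a. (norm (x - a))\<^sup>2) ` \<alpha>))"
      let ?C = "\<lambda>x a. ennreal (R\<^sup>2 - (norm (x - a))\<^sup>2)"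
      define S where "S = (\<Sum>k<m. \<integral>\<^sup>+ t. ?D (?g k t) * indicator {0..l} t \<partial>lborel)"
      have [measurable]: "?D \<in> borel_measurable borel"
        using \<alpha>(1) by measurable
      have "ennreal (L * R\<^sup>2) = (\<Sum>k<m. \<integral>\<^sup>+ t. ennreal (R\<^sup>2) * indicator ?A t \<partial>lborel)"
        using \<epsilon> by (simp add: nn_integral_cmult_indicator L_def
            ennreal_of_nat_eq_real_of_nat flip: ennreal_mult)
      \<comment> \<open>Off \<open>?A\<close> the left integrand vanishes, so the distance term may
        be taken over the whole side while the caps stay on the trimmed piece.\<close>
      also have "\<dots> \<le> (\<Sum>k<m. \<integral>\<^sup>+ t. ?D (?g k t) * indicator {0..l} t
          + (\<Sum>a\<in>\<alpha>. ?C (?g k t) a * indicator ?A t) \<partial>lborel)"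
      proof (intro sum_mono nn_integral_mono)
        fix k t
        show "ennreal (R\<^sup>2) * indicator ?A t
            \<le> ?D (?g k t) * indicator {0..l} t + (\<Sum>a\<in>\<alpha>. ?C (?g k t) a * indicator ?A t)"
          using square_le_Min_plus_sum_cap[OF \<alpha>(1,2), of "R\<^sup>2" "\<lambda>a. (norm (?g k t - a))\<^sup>2"] \<epsilon>
          by (auto simp: indicator_def)
      qed
      also have "\<dots> = S + (\<Sum>k<m. \<Sum>a\<in>\<alpha>. \<integral>\<^sup>+ t. ?C (?g k t) a * indicator ?A t \<partial>lborel)"
        by (simp add: nn_integral_add nn_integral_sum sum.distrib S_def)
      \<comment> \<open>After the exchange, the inner sum runs over all pieces for one fixed centre,
        and separation bounds it by a single cap.\<close>
      also have "(\<Sum>k<m. \<Sum>a\<in>\<alpha>. \<integral>\<^sup>+ t. ?C (?g k t) a * indicator ?A t \<partial>lborel)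
          = (\<Sum>a\<in>\<alpha>. \<Sum>k<m. \<integral>\<^sup>+ t. ?C (?g k t) a * indicator ?A t \<partial>lborel)"
        by (rule sum.swap)
      also have "\<dots> \<le> (\<Sum>a\<in>\<alpha>. ennreal (4 * R ^ 3 / 3))"
        using R \<delta> m by (intro sum_mono sum_nn_integral_cap_le[where \<delta> = \<delta>])
          (auto simp: polygon_vertex_neq_Suc)
      also have "\<dots> \<le> ennreal (real n * (4 * R ^ 3 / 3))"
        using \<alpha>(3) R
        by (simp add: ennreal_of_nat_eq_real_of_nat flip: ennreal_mult)
      finally have "ennreal (L * R\<^sup>2) \<le> S + ennreal (real n * (4 * R ^ 3 / 3))"
        by (simp add: add_left_mono)
      then have "ennreal (L * R\<^sup>2) - ennreal (real n * (4 * R ^ 3 / 3)) \<le> S"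
        by (simp add: ennreal_minus_le_iff add.commute)
      then have "ennreal (L * R\<^sup>2 - real n * (4 * R ^ 3 / 3)) \<le> S"
        using R by (simp add: ennreal_minus)
      \<comment> \<open>The two terms are \<open>L ^ 3 / (4 * n ^ 2)\<close> and
        \<open>L ^ 3 / (6 * n ^ 2)\<close>, which explains the constant 12.\<close>
      also have "L * R\<^sup>2 - real n * (4 * R ^ 3 / 3) = L ^ 3 / (12 * (real n)\<^sup>2)"
        using elim by (simp add: R_def power2_eq_square power3_eq_cube field_simps)
      finally have "ennreal (1 / (real m * l)) * ennreal (L ^ 3 / (12 * (real n)\<^sup>2))
          \<le> ennreal (1 / (real m * l)) * S"
        by (intro mult_left_mono) auto
      also have "\<dots> = distortion (uniform_polygon m c \<theta>) \<alpha>"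
        using distortion_uniform_polygon[OF m \<alpha>(1)] by (simp add: S_def l_def)
      finally show "ennreal (L ^ 3 / (12 * real m * l * (real n)\<^sup>2))
          \<le> distortion (uniform_polygon m c \<theta>) \<alpha>"
        using l L by (simp add: mult_ac flip: ennreal_mult)
    qed
  qed
qed

section \<open>Upper bound for the quantization error\<close>

lemma exists_equal_subinterval:
  assumes "0 \<le> t" "t \<le> real k * h" "k > 0"
  shows "\<exists>i<k. real i * h \<le> t \<and> t \<le> (real i + 1) * h"
  using assms(2,3)
proof (induction k)
  case (Suc k)
  show ?case
  proof (cases "k > 0 \<and> t \<le> real k * h")
    case True
    then show ?thesis using Suc.IH less_Suc_eq by blast
  next
    case False
    then show ?thesis
      using Suc.prems assms(1) by (intro exI[of _ k]) (auto simp: algebra_simps)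
  qed
qed simp

text \<open>With \<open>k = n div m\<close> centres per side at most \<open>n\<close> are used, and
  \<open>n \<ge> m\<close> makes \<open>k\<close> positive. The centres sit at the midpoints
  \<open>u i\<close> of \<open>k\<close> intervals of length \<open>h = l / k\<close>.\<close>

lemma quantization_error_polygon_le:
  fixes m :: nat
  defines "l \<equiv> 2 * sin (pi / real m)"
  assumes m: "m \<ge> 3" and n: "n \<ge> m"
  shows "quantization_error (uniform_polygon m c \<theta>) n \<le> ennreal (l\<^sup>2 / (12 * (real (n div m))\<^sup>2))"
proof -
  let ?p = "polygon_vertex m c \<theta>"
  let ?g = "\<lambda>k. unit_param (?p k) (?p (Suc k))"
  define k where "k = n div m"
  define h where "h = l / real k"
  define u where "u = (\<lambda>i. (real i + 1 / 2) * h)"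
  define \<alpha> where "\<alpha> = (\<lambda>(j, i). ?g j (u i)) ` ({..<m} \<times> {..<k})"
  have k: "k > 0"
    using m n by (simp add: k_def div_greater_zero_iff)
  have l: "l > 0"
    using polygon_side_pos[OF m] by (simp add: l_def)
  have h: "h > 0" "real k * h = l"
    using k l by (auto simp: h_def)
  have fin: "finite \<alpha>" and ne: "\<alpha> \<noteq> {}"
    using m k by (auto simp: \<alpha>_def lessThan_empty_iff)
  have "card \<alpha> \<le> card ({..<m} \<times> {..<k})"
    unfolding \<alpha>_def by (intro card_image_le) auto
  also have "\<dots> \<le> n"
    by (simp add: k_def)
  finally have card: "card \<alpha> \<le> n" .
  let ?D = "\<lambda>x. ennreal (Min ((\<lambda>a. (norm (x - a))\<^sup>2) ` \<alpha>))"
  \<comment> \<open>The minimum is bounded by the distance to the midpoint of a subinterval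
    containing \<open>t\<close>. Summing over all subintervals only enlarges the right side, also at
    common endpoints.\<close>
  have pw: "?D (?g j t) * indicator {0..l} t
      \<le> (\<Sum>i<k. ennreal ((t - u i)\<^sup>2) * indicator {u i - h / 2..u i + h / 2} t)"
    if j: "j < m" for j t
  proof (cases "t \<in> {0..l}")
    case True
    then obtain i where i: "i < k" "real i * h \<le> t" "t \<le> (real i + 1) * h"
      using exists_equal_subinterval[of t k h] h k by auto
    have "Min ((\<lambda>a. (norm (?g j t - a))\<^sup>2) ` \<alpha>) \<le> (norm (?g j t - ?g j (u i)))\<^sup>2"
      using fin i(1) j by (intro Min_le) (auto simp: \<alpha>_def)
    also have "\<dots> = (t - u i)\<^sup>2"
      using polygon_vertex_neq_Suc[OF m] by (simp add: norm_unit_param_diff)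
    finally have "?D (?g j t) * indicator {0..l} t
        \<le> ennreal ((t - u i)\<^sup>2) * indicator {u i - h / 2..u i + h / 2} t"
      using True i by (auto simp: indicator_def u_def algebra_simps intro!: ennreal_leI)
    also have "\<dots> \<le> (\<Sum>i<k. ennreal ((t - u i)\<^sup>2) * indicator {u i - h / 2..u i + h / 2} t)"
      using i(1) by (intro member_le_sum) auto
    finally show ?thesis .
  qed simp
  have side: "(\<integral>\<^sup>+ t. ?D (?g j t) * indicator {0..l} t \<partial>lborel) \<le> ennreal (l ^ 3 / (12 * (real k)\<^sup>2))"
    if "j < m" for j
  proof -
    have "(\<integral>\<^sup>+ t. ?D (?g j t) * indicator {0..l} t \<partial>lborel)
        \<le> (\<integral>\<^sup>+ t. (\<Sum>i<k. ennreal ((t - u i)\<^sup>2) * indicator {u i - h / 2..u i + h / 2} t) \<partial>lborel)"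
      using pw that by (intro nn_integral_mono) auto
    \<comment> \<open>Each subinterval has second moment \<open>h ^ 3 / 12\<close> about its
      midpoint; \<open>k\<close> of them give \<open>l ^ 3 / (12 * k ^ 2)\<close>.\<close>
    also have "\<dots> = (\<Sum>i<k. ennreal (2 * (h / 2) ^ 3 / 3))"
      using h by (subst nn_integral_sum) (auto simp: nn_integral_square_Icc)
    also have "\<dots> = ennreal (real k * (2 * (h / 2) ^ 3 / 3))"
      using h by (simp add: ennreal_of_nat_eq_real_of_nat flip: ennreal_mult)
    also have "real k * (2 * (h / 2) ^ 3 / 3) = l ^ 3 / (12 * (real k)\<^sup>2)"
      using k by (simp add: h_def power2_eq_square power3_eq_cube field_simps)
    finally show ?thesis .
  qed
  have "quantization_error (uniform_polygon m c \<theta>) n \<le> distortion (uniform_polygon m c \<theta>) \<alpha>"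
    unfolding quantization_error_def using fin ne card
    by (intro INF_lower) (auto simp: Suc_le_eq card_gt_0_iff)
  also have "\<dots> = ennreal (1 / (real m * l))
      * (\<Sum>j<m. \<integral>\<^sup>+ t. ?D (?g j t) * indicator {0..l} t \<partial>lborel)"
    using distortion_uniform_polygon[OF m fin] by (simp add: l_def)
  also have "\<dots> \<le> ennreal (1 / (real m * l)) * (\<Sum>j<m. ennreal (l ^ 3 / (12 * (real k)\<^sup>2)))"
    using side by (intro mult_left_mono sum_mono) auto
  also have "\<dots> = ennreal (1 / (real m * l)) * ennreal (real m * (l ^ 3 / (12 * (real k)\<^sup>2)))"
    using l by (simp add: ennreal_of_nat_eq_real_of_nat flip: ennreal_mult)
  also have "\<dots> = ennreal (1 / (real m * l) * (real m * (l ^ 3 / (12 * (real k)\<^sup>2))))"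
    using l by (intro ennreal_mult[symmetric]) auto
  also have "1 / (real m * l) * (real m * (l ^ 3 / (12 * (real k)\<^sup>2))) = l\<^sup>2 / (12 * (real k)\<^sup>2)"
    using l m k by (simp add: power2_eq_square power3_eq_cube field_simps)
  finally show ?thesis
    unfolding k_def .
qed

section \<open>Passage to the limit\<close>

text \<open>The remainder \<open>n mod m\<close> is nonnegative and below \<open>m\<close>, so the
  ratio exceeds \<open>m\<close> by at most \<open>m / (n div m)\<close>, which tends to 0.\<close>

lemma tendsto_div_ratio:
  assumes "m > 0"
  shows "(\<lambda>n. real n / real (n div m)) \<longlonglongrightarrow> real m"
proof (rule tendsto_sandwich)
  have n: "real n = real m * real (n div m) + real (n mod m)" for n
    by (metis mult_div_mod_eq of_nat_add of_nat_mult)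
  have pos: "\<forall>\<^sub>F n in sequentially. 0 < n div m"
    using eventually_ge_at_top[of m] by eventually_elim (use assms in \<open>simp add: div_greater_zero_iff\<close>)
  then show "\<forall>\<^sub>F n in sequentially. real m \<le> real n / real (n div m)"
    by eventually_elim (subst n, simp add: field_simps)
  show "\<forall>\<^sub>F n in sequentially. real n / real (n div m) \<le> real m + real m / real (n div m)"
    using pos
  proof eventually_elim
    case (elim n)
    have "real n \<le> real m * real (n div m) + real m"
      using n[of n] assms mod_less_divisor[of m n] by linarith
    then show ?case
      using elim by (simp add: field_simps)
  qed
  have "filterlim (\<lambda>n. n div m) sequentially sequentially"
    using assms by (rule filterlim_at_top_div_const_nat)
  then have "filterlim (\<lambda>n. real (n div m)) at_top sequentially"
    using filterlim_compose[OF filterlim_real_sequentially] by blast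
  then have "(\<lambda>n. real m / real (n div m)) \<longlonglongrightarrow> 0"
    by (intro real_tendsto_divide_at_top[OF tendsto_const])
  then show "(\<lambda>n. real m + real m / real (n div m)) \<longlonglongrightarrow> real m"
    using tendsto_add[OF tendsto_const[of "real m"]] by fastforce
qed simp

text \<open>The lower bound depends on \<open>\<epsilon>\<close> and its range of \<open>n\<close>
  does too, so each level \<open>b\<close> below the limit gets its own \<open>\<epsilon>\<close>.
  Levels above the limit follow directly from the midpoint bound.\<close>

lemma quantization_error_polygon_limit:
  fixes m :: nat
  defines "l \<equiv> 2 * sin (pi / real m)"
  assumes m: "m \<ge> 3"
  shows "(\<lambda>n. ennreal ((real n)\<^sup>2) * quantization_error (uniform_polygon m c \<theta>) n)
    \<longlonglongrightarrow> ennreal ((real m * l)\<^sup>2 / 12)"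
    (is "?f \<longlonglongrightarrow> ennreal ?c")
proof (rule order_tendstoI)
  have l: "l > 0"
    using polygon_side_pos[OF m] by (simp add: l_def)
  fix b assume b: "b < ennreal ?c"
  \<comment> \<open>As \<open>\<epsilon>\<close> tends to 0 the trimmed length tends to the
    perimeter \<open>m * l\<close>, so some admissible \<open>\<epsilon>\<close> keeps the bound
    above \<open>b\<close>.\<close>
  have "((\<lambda>\<epsilon>. ennreal ((real m * (l - 2 * \<epsilon>)) ^ 3 / (12 * real m * l)))
      \<longlongrightarrow> ennreal ((real m * (l - 2 * 0)) ^ 3 / (12 * real m * l))) (at_right 0)"
    by (intro tendsto_intros) (use l m in auto)
  moreover have "(real m * (l - 2 * 0)) ^ 3 / (12 * real m * l) = ?c"
    using l m by (simp add: power2_eq_square power3_eq_cube field_simps)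
  ultimately have "((\<lambda>\<epsilon>. ennreal ((real m * (l - 2 * \<epsilon>)) ^ 3 / (12 * real m * l)))
      \<longlongrightarrow> ennreal ?c) (at_right 0)"
    by (simp only:)
  from order_tendstoD(1)[OF this b]
  have "\<forall>\<^sub>F \<epsilon> in at_right 0. b < ennreal ((real m * (l - 2 * \<epsilon>)) ^ 3 / (12 * real m * l))" .
  moreover have "\<forall>\<^sub>F \<epsilon> in at_right 0. 0 < \<epsilon> \<and> 2 * \<epsilon> < l"
    using l unfolding eventually_at_right_field by (intro exI[of _ "l / 2"]) auto
  ultimately have "\<forall>\<^sub>F \<epsilon> in at_right 0. b < ennreal ((real m * (l - 2 * \<epsilon>)) ^ 3 / (12 * real m * l))
      \<and> 0 < \<epsilon> \<and> 2 * \<epsilon> < l"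
    by (rule eventually_conj)
  from eventually_happens[OF this]
  obtain \<epsilon> where \<epsilon>: "b < ennreal ((real m * (l - 2 * \<epsilon>)) ^ 3 / (12 * real m * l))"
    "0 < \<epsilon>" "2 * \<epsilon> < l"
    by auto
  let ?L = "real m * (l - 2 * \<epsilon>)"
  have "\<forall>\<^sub>F n in sequentially. ennreal (?L ^ 3 / (12 * real m * l * (real n)\<^sup>2))
      \<le> quantization_error (uniform_polygon m c \<theta>) n"
    using \<epsilon> m unfolding l_def by (intro quantization_error_polygon_ge) auto
  then show "\<forall>\<^sub>F n in sequentially. b < ?f n"
    using eventually_gt_at_top[of 0]
  proof eventually_elim
    case (elim n)
    have "ennreal (?L ^ 3 / (12 * real m * l))
        = ennreal ((real n)\<^sup>2 * (?L ^ 3 / (12 * real m * l * (real n)\<^sup>2)))"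
      using elim(2) by (simp add: field_simps)
    also have "\<dots> = ennreal ((real n)\<^sup>2) * ennreal (?L ^ 3 / (12 * real m * l * (real n)\<^sup>2))"
      using \<epsilon> l by (intro ennreal_mult) auto
    also have "\<dots> \<le> ?f n"
      using elim(1) by (intro mult_left_mono) auto
    finally show ?case
      using \<epsilon>(1) by simp
  qed
next
  fix b assume b: "ennreal ?c < b"
  \<comment> \<open>This is \<open>n ^ 2\<close> times the midpoint bound; rounding \<open>n\<close>
    down to a multiple of \<open>m\<close> disappears in the limit.\<close>
  have "(\<lambda>n. ennreal ((real n / real (n div m))\<^sup>2 * l\<^sup>2 / 12)) \<longlonglongrightarrow> ennreal ((real m)\<^sup>2 * l\<^sup>2 / 12)"
    using m by (intro tendsto_intros tendsto_div_ratio) auto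
  then have "(\<lambda>n. ennreal ((real n / real (n div m))\<^sup>2 * l\<^sup>2 / 12)) \<longlonglongrightarrow> ennreal ?c"
    by (simp only: power_mult_distrib)
  from order_tendstoD(2)[OF this b]
  have "\<forall>\<^sub>F n in sequentially. ennreal ((real n / real (n div m))\<^sup>2 * l\<^sup>2 / 12) < b" .
  then show "\<forall>\<^sub>F n in sequentially. ?f n < b"
    using eventually_ge_at_top[of m]
  proof eventually_elim
    case (elim n)
    have "?f n \<le> ennreal ((real n)\<^sup>2) * ennreal (l\<^sup>2 / (12 * (real (n div m))\<^sup>2))"
      using quantization_error_polygon_le[OF m elim(2)] by (simp add: l_def mult_left_mono)
    also have "\<dots> = ennreal ((real n)\<^sup>2 * (l\<^sup>2 / (12 * (real (n div m))\<^sup>2)))"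
      by (intro ennreal_mult[symmetric]) auto
    also have "\<dots> = ennreal ((real n / real (n div m))\<^sup>2 * l\<^sup>2 / 12)"
      by (simp add: power_divide)
    also note elim(1)
    finally show ?case .
  qed
qed

text \<open>Positivity ensures that \<open>ennreal\<close> does not truncate the constant. The last
  conjunct states the limit with an ordinary square in place of \<open>powr\<close>.\<close>

theorem theorem2p4:
  fixes m :: nat and c :: "real^2" and \<theta> :: real and P :: "(real^2) measure"
  assumes "m \<ge> 3"
    and "P = uniform_polygon m c \<theta>"
  shows "0 < 1 / 3 * (real m)\<^sup>2 * (sin (pi / real m))\<^sup>2
    \<and> has_quantization_coefficient P 1 (1 / 3 * (real m)\<^sup>2 * (sin (pi / real m))\<^sup>2)
    \<and> (\<lambda>n. of_nat n ^ 2 * quantization_error P n)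
        \<longlonglongrightarrow> ennreal (1 / 3 * (real m)\<^sup>2 * (sin (pi / real m))\<^sup>2)"
proof -
  have eq: "(real m * (2 * sin (pi / real m)))\<^sup>2 / 12 = 1 / 3 * (real m)\<^sup>2 * (sin (pi / real m))\<^sup>2"
    by (simp add: power_mult_distrib)
  have lim: "(\<lambda>n. ennreal ((real n)\<^sup>2) * quantization_error P n)
      \<longlonglongrightarrow> ennreal (1 / 3 * (real m)\<^sup>2 * (sin (pi / real m))\<^sup>2)"
    using quantization_error_polygon_limit[OF assms(1)] unfolding assms(2) eq .
  \<comment> \<open>At \<open>n = 0\<close> both sides are 0, since
    \<open>0 powr x = 0\<close>.\<close>
  have "real n powr (2 / 1) = (real n)\<^sup>2" for n
    by (cases "n = 0") (simp_all add: powr_numeral)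
  moreover have "of_nat n ^ 2 = ennreal ((real n)\<^sup>2)" for n
    by (simp add: ennreal_of_nat_eq_real_of_nat ennreal_power)
  moreover have "0 < 1 / 3 * (real m)\<^sup>2 * (sin (pi / real m))\<^sup>2"
    using polygon_side_pos[OF assms(1)] assms(1) by simp
  ultimately show ?thesis
    using lim by (simp only: has_quantization_coefficient_def simp_thms)
qed

end
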